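(* The closure $\overline{\Omega}$ of $\Omega$ in $\mathbb{C}$ is $$\overline{\Omega}=\mathbb{D}\cup\{z\in\mathbb{C} : |z|>1 \text{ and } z^{-1}\in\mathcal{G}\},$$ where $\mathbb{D}=\{z\in\mathbb{C} : |z|\leq1\}$.
   Context: Let $m\geq 1$ be an integer, $\beta\in(m,m+1]$ and $E=(E(0),\ldots,E(m))\in\{1,-1\}^{m+1}$. Partition $[0,1]$ into $I_0=[0,1/\beta]$, $I_k=(k/\beta,(k+1)/\beta]$ for $1\leq k\leq m-1$, and $I_m=(m/\beta,1]$. The generalized $\beta$-transformation $f=f_{\beta,E}:[0,1]\to[0,1]$ is given by $f(x)=\beta x-k$ if $x\in I_k$ and $E(k)=1$, and $f(x)=-\beta x+k+1$ if $x\in I_k$ and $E(k)=-1$. It is post-critically finite (PCF) if $\{f^j(1): j\geq 0\}$ is a finite set. A real number $\beta>1$ is a generalized Parry number if there is an $E\in\{1,-1\}^{m+1}$ (where $\beta\in(m,m+1]$) such that $f_{\beta,E}$ is PCF; such a $\beta$ is algebraic. $\Omega\subset\mathbb{C}$ denotes the set of all Galois conjugates of all generalized Parry numbers, where the Galois conjugates of $\beta$ are the complex roots, other than $\beta$ itself, of the minimal polynomial of $\beta$ over $\mathbb{Q}$. Let $\mathcal{F}=\{T(w)=1+\sum_{j=1}^\infty a_jw^j : a_j\in[-1,1] \text{ for all } j\geq1\}$, regarded as analytic functions on the open unit disk, and let $\mathcal{G}$ denote the set of zeros of functions in $\mathcal{F}$. *)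

theory Defs
  imports "HOL-Analysis.Analysis" "HOL-Computational_Algebra.Computational_Algebra"
begin

definition beta_interval :: "nat \<Rightarrow> real \<Rightarrow> nat \<Rightarrow> real set" where
  "beta_interval m \<beta> k =
     (if k = 0 then {0..1 / \<beta>}
      else if k = m then {real m / \<beta><..1}
      else {real k / \<beta><..(real k + 1) / \<beta>})"

text \<open>
  For \<open>m \<ge> 1\<close> and \<open>\<beta> \<in> (m, m + 1]\<close> the branch is well defined on \<open>[0, 1]\<close>,
  see \<open>beta_interval_partition\<close>. Only the values \<open>E k\<close> with \<open>k \<le> m\<close> matter.
\<close>

definition beta_branch :: "nat \<Rightarrow> real \<Rightarrow> real \<Rightarrow> nat" where
  "beta_branch m \<beta> x = (THE k. k \<le> m \<and> x \<in> beta_interval m \<beta> k)"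

definition gen_beta_map :: "nat \<Rightarrow> real \<Rightarrow> (nat \<Rightarrow> int) \<Rightarrow> real \<Rightarrow> real" where
  "gen_beta_map m \<beta> E x =
     (let k = beta_branch m \<beta> x
      in if E k = 1 then \<beta> * x - real k else - \<beta> * x + real k + 1)"

definition PCF :: "nat \<Rightarrow> real \<Rightarrow> (nat \<Rightarrow> int) \<Rightarrow> bool" where
  "PCF m \<beta> E \<longleftrightarrow> finite {(gen_beta_map m \<beta> E ^^ j) 1 | j. True}"

definition gen_parry_number :: "real \<Rightarrow> bool" where
  "gen_parry_number \<beta> \<longleftrightarrow> \<beta> > 1 \<and>
     (\<exists>m::nat. m \<ge> 1 \<and> \<beta> \<in> {real m<..real m + 1} \<and>
        (\<exists>E \<in> {..m} \<rightarrow> {1, -1}. PCF m \<beta> E))"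

definition rat_root :: "rat poly \<Rightarrow> complex \<Rightarrow> bool" where
  "rat_root p z \<longleftrightarrow> poly (map_poly of_rat p) z = 0"

definition is_min_poly :: "rat poly \<Rightarrow> complex \<Rightarrow> bool" where
  "is_min_poly p z \<longleftrightarrow> lead_coeff p = 1 \<and> rat_root p z \<and>
     (\<forall>q. q \<noteq> 0 \<and> rat_root q z \<longrightarrow> degree p \<le> degree q)"

definition galois_conjugates :: "real \<Rightarrow> complex set" where
  "galois_conjugates \<beta> =
     {z. \<exists>p. is_min_poly p (of_real \<beta>) \<and> rat_root p z \<and> z \<noteq> of_real \<beta>}"

definition \<Omega> :: "complex set" where
  "\<Omega> = (\<Union>\<beta> \<in> {\<beta>. gen_parry_number \<beta>}. galois_conjugates \<beta>)"

text \<open>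
  Elements of \<open>\<F>\<close> are total functions; their values outside the open unit disk are
  unconstrained and never used.
\<close>

definition \<F> :: "(complex \<Rightarrow> complex) set" where
  "\<F> = {T. \<exists>a :: nat \<Rightarrow> real. (\<forall>j\<ge>1. a j \<in> {-1..1}) \<and>
           (\<forall>w \<in> ball 0 1. T w = 1 + (\<Sum>j. of_real (a (Suc j)) * w ^ Suc j))}"

definition \<G> :: "complex set" where
  "\<G> = {w \<in> ball 0 1. \<exists>T \<in> \<F>. T w = 0}"


lemma beta_interval_iff:
  assumes "m \<ge> 1" "\<beta> \<in> {real m<..real m + 1}" "x \<in> {0..1}" "k \<le> m"
  shows "x \<in> beta_interval m \<beta> k \<longleftrightarrow>
    (if k = 0 then \<beta> * x \<le> 1 else real k < \<beta> * x \<and> \<beta> * x \<le> real k + 1)"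
proof -
  have pos: "\<beta> > 0" using assms by auto
  have "\<beta> * x \<le> \<beta>" using pos assms(3) by (simp add: mult_left_le)
  then have "\<beta> * x \<le> real m + 1" using assms(2) by (meson greaterThanAtMost_iff order_trans)
  then show ?thesis
    using pos assms by (auto simp: beta_interval_def field_simps)
qed

lemma beta_interval_partition:
  assumes "m \<ge> 1" "\<beta> \<in> {real m<..real m + 1}" "x \<in> {0..1}"
  shows "\<exists>!k. k \<le> m \<and> x \<in> beta_interval m \<beta> k"
proof -
  have pos: "\<beta> > 0" using assms by auto
  have "\<beta> * x \<le> \<beta>" using pos assms(3) by (simp add: mult_left_le)
  then have ub: "\<beta> * x \<le> real m + 1"
    using assms(2) by (meson greaterThanAtMost_iff order_trans)
  have lb: "0 \<le> \<beta> * x" using pos assms(3) by simp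
  define k where "k = (if \<beta> * x \<le> 1 then 0 else nat (\<lceil>\<beta> * x\<rceil> - 1))"
  have k: "k \<le> m \<and> x \<in> beta_interval m \<beta> k"
  proof (cases "\<beta> * x \<le> 1")
    case True
    then show ?thesis using beta_interval_iff[OF assms, of 0] by (simp add: k_def)
  next
    case False
    then have gt: "\<lceil>\<beta> * x\<rceil> \<ge> 2" by linarith
    then have rk: "real k = of_int \<lceil>\<beta> * x\<rceil> - 1" and "k \<noteq> 0"
      using False by (auto simp: k_def)
    moreover have "\<lceil>\<beta> * x\<rceil> \<le> int m + 1" using ub by (simp add: ceiling_le_iff)
    then have "k \<le> m" using False by (auto simp: k_def)
    moreover have "real k < \<beta> * x" "\<beta> * x \<le> real k + 1" using rk by linarith+
    ultimately show ?thesis using beta_interval_iff[OF assms, of k] by simp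
  qed
  show ?thesis
  proof (rule ex1I[of _ k])
    show "k \<le> m \<and> x \<in> beta_interval m \<beta> k" by (fact k)
    fix l assume l: "l \<le> m \<and> x \<in> beta_interval m \<beta> l"
    show "l = k"
      using k l beta_interval_iff[OF assms, of k] beta_interval_iff[OF assms, of l]
      by (auto split: if_splits)
  qed
qed

lemma beta_branch_eq:
  assumes "m \<ge> 1" "\<beta> \<in> {real m<..real m + 1}" "x \<in> {0..1}"
    and "k \<le> m" "x \<in> beta_interval m \<beta> k"
  shows "beta_branch m \<beta> x = k"
  unfolding beta_branch_def
  using beta_interval_partition[OF assms(1-3)] assms(4,5) by (intro the1_equality) auto

lemma gen_beta_map_mem:
  assumes "m \<ge> 1" "\<beta> \<in> {real m<..real m + 1}" "x \<in> {0..1}"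
  shows "gen_beta_map m \<beta> E x \<in> {0..1}"
proof -
  obtain k where k: "k \<le> m" "x \<in> beta_interval m \<beta> k"
    using beta_interval_partition[OF assms] by blast
  have "0 \<le> \<beta> * x" using assms by auto
  then show ?thesis
    using beta_interval_iff[OF assms k(1)] k(2) beta_branch_eq[OF assms k]
    by (auto simp: gen_beta_map_def split: if_splits)
qed

lemma is_min_poly_unique:
  assumes "is_min_poly p z" "is_min_poly q z"
  shows "p = q"
proof (rule ccontr)
  assume "p \<noteq> q"
  have nz: "p \<noteq> 0" "q \<noteq> 0" using assms by (auto simp: is_min_poly_def)
  have deg: "degree p = degree q"
    using assms nz by (auto simp: is_min_poly_def intro: le_antisym)
  have "map_poly of_rat (p - q) = (map_poly of_rat p - map_poly of_rat q :: complex poly)"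
    by (intro poly_eqI) (simp add: coeff_map_poly of_rat_diff)
  then have "rat_root (p - q) z" using assms by (simp add: is_min_poly_def rat_root_def)
  then have le: "degree p \<le> degree (p - q)"
    using assms(1) \<open>p \<noteq> q\<close> by (auto simp: is_min_poly_def)
  have "degree (p - q) \<le> degree p" using degree_diff_le[of p "degree p" q] deg by simp
  then have "lead_coeff (p - q) = coeff p (degree p) - coeff q (degree q)"
    using le deg by simp
  also have "\<dots> = 0" using assms by (simp add: is_min_poly_def)
  finally show False using \<open>p \<noteq> q\<close> by (simp only: leading_coeff_0_iff right_minus_eq)
qed

lemma summable_\<F>:
  fixes a :: "nat \<Rightarrow> real" and w :: complex
  assumes "\<forall>j\<ge>1. a j \<in> {-1..1}" "w \<in> ball 0 1"
  shows "summable (\<lambda>j. of_real (a (Suc j)) * w ^ Suc j)"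
proof (rule summable_comparison_test)
  have "\<bar>a (Suc j)\<bar> \<le> 1" for j using assms(1)[rule_format, of "Suc j"] by auto
  then show "\<exists>N. \<forall>n\<ge>N. norm (of_real (a (Suc n)) * w ^ Suc n) \<le> norm w ^ Suc n"
    by (auto simp: norm_mult norm_power mult_left_le_one_le simp del: power_Suc)
  show "summable (\<lambda>n. norm w ^ Suc n)"
    using assms(2) by (simp add: summable_geometric summable_mult)
qed

end

theory Submission
  imports Defs
begin

text \<open>
  For \<open>z\<close> a conjugate of \<open>\<beta>\<close> with \<open>\<bar>z\<bar> > 1\<close>, write the signed orbit of 1 as \<open>y\<^sub>n = p\<^sub>n(\<beta>)\<close> with monic
  integer polynomials \<open>p\<^sub>n\<close> built by a Horner recursion. As \<open>y\<^sub>n\<close> takes finitely many values, so does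
  \<open>p\<^sub>n(z)\<close>; telescoping then shows that the power series with coefficients \<open>y\<^sub>n\<close>, an element of
  \<open>\<F>\<close>, vanishes at \<open>1/z\<close>. The right-hand side is closed because the coefficient space
  \<open>[-1,1]\<^sup>\<nat>\<close> is compact.

  Conversely, let \<open>z\<close> be a root of \<open>x\<^sup>n + a\<^sub>1 x\<^sup>n\<^sup>-\<^sup>1 + \<dots> + a\<^sub>n\<close> with real \<open>\<bar>a\<^sub>j\<bar> \<le> 1\<close>. After a small perturbation
  the numbers \<open>1, \<bar>a\<^sub>1\<bar>, \<dots>, \<bar>a\<^sub>n\<bar>\<close> are distinct and nonzero, so that for large \<open>\<beta>\<close> they lie in
  distinct branches and the signs \<open>E\<close> can be chosen freely along an orbit close to them. The integer
  digits can moreover be taken even, with the last one congruent to 2 modulo 4, so that the equation of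
  \<open>\<beta>\<close> is irreducible by Eisenstein's criterion; its roots other than \<open>\<beta>\<close> are
  the roots of a polynomial with coefficients close to the \<open>a\<^sub>j\<close>, and one of them is close to \<open>z\<close>.
  It remains to approximate by roots of such polynomials: a zero of a series in \<open>\<F>\<close> is first pushed
  slightly outwards, which leaves room to absorb the tail of the series into two coefficients, and a
  nonreal \<open>z\<close> with \<open>\<bar>z\<bar> < 1\<close> satisfies \<open>z\<^sup>n + s z + t = 0\<close> with small \<open>s\<close>, \<open>t\<close> once \<open>n\<close> is large.
\<close>

section \<open>Monic polynomials and Eisensteins criterion\<close>

text \<open>New coefficients enter at the constant end, so evaluation at \<beta> iterates t ->
  \<beta> t + \<open>c n\<close>: the polynomials for n = 0, 1, ... trace one signed orbit, and the
  last digit is the constant coefficient.\<close>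

primrec horner :: "(nat \<Rightarrow> 'a::comm_ring_1) \<Rightarrow> nat \<Rightarrow> 'a poly" where
  "horner c 0 = 1"
| "horner c (Suc n) = pCons (c n) (horner c n)"

lemma horner_monic: "degree (horner c n) = n \<and> coeff (horner c n) n = 1"
proof (induction n)
  case (Suc n)
  then have "horner c n \<noteq> 0" by force
  with Suc show ?case by simp
qed simp

lemma degree_horner [simp]: "degree (horner c n) = n"
  and lead_coeff_horner [simp]: "coeff (horner c n) n = 1"
  using horner_monic[of c n] by auto

lemma horner_nonzero [simp]: "horner c n \<noteq> 0"
  using lead_coeff_horner[of c n] by (metis coeff_0 zero_neq_one)

lemma coeff_horner: "i < n \<Longrightarrow> coeff (horner c n) i = c (n - Suc i)"
proof (induction n arbitrary: i)
  case (Suc n)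
  then show ?case by (cases i) auto
qed simp

lemma poly_horner: "poly (horner c n) x = x ^ n + (\<Sum>i<n. c i * x ^ (n - Suc i))"
proof (induction n)
  case (Suc n)
  have "(\<Sum>i<n. c i * x ^ (n - i)) = x * (\<Sum>i<n. c i * x ^ (n - Suc i))"
    unfolding sum_distrib_left
  proof (rule sum.cong)
    fix i assume "i \<in> {..<n}"
    then have "x ^ (n - i) = x * x ^ (n - Suc i)"
      by (metis Suc_diff_Suc lessThan_iff power_Suc)
    then show "c i * x ^ (n - i) = x * (c i * x ^ (n - Suc i))" by simp
  qed simp
  with Suc show ?case by (simp add: algebra_simps)
qed simp

text \<open>Synthetic division: the intermediate Horner values at \<open>b\<close> are the
  coefficients of the quotient by x - b. If the orbit ends in 0, the remaining roots thus solve a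
  monic equation whose coefficients are orbit points.\<close>

lemma poly_horner_factor:
  fixes y :: "nat \<Rightarrow> 'a::comm_ring_1"
  assumes "\<And>j. y j = poly (horner c j) b"
  shows "poly (horner c (Suc n)) x = (x - b) * poly (horner (\<lambda>i. y (Suc i)) n) x + y (Suc n)"
proof (induction n)
  case 0
  show ?case by (simp add: assms)
next
  case (Suc n)
  have "poly (horner c (Suc (Suc n))) x = c (Suc n) + x * poly (horner c (Suc n)) x" by simp
  moreover have "y (Suc (Suc n)) = c (Suc n) + b * y (Suc n)" by (simp add: assms)
  ultimately show ?case unfolding Suc by (simp add: algebra_simps)
qed

lemma map_poly_of_int_horner:
  "map_poly of_int (horner c n) = (horner (\<lambda>i. of_int (c i)) n :: rat poly)"
  by (induction n) (simp_all add: map_poly_pCons)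

lemma of_real_poly_horner:
  "of_real (poly (horner c n) x) = poly (horner (\<lambda>i. of_real (c i)) n) (of_real x)"
  by (induction n) simp_all

section \<open>Rational polynomials at complex points and minimal polynomials\<close>

definition rat_eval :: "rat poly \<Rightarrow> complex \<Rightarrow> complex" where
  "rat_eval p z = poly (map_poly of_rat p) z"

lemma rat_root_iff: "rat_root p z \<longleftrightarrow> rat_eval p z = 0"
  by (simp add: rat_root_def rat_eval_def)

lemma rat_eval_pCons [simp]: "rat_eval (pCons a p) z = of_rat a + z * rat_eval p z"
  by (simp add: rat_eval_def map_poly_pCons)

lemma rat_eval_0 [simp]: "rat_eval 0 z = 0" and rat_eval_1 [simp]: "rat_eval 1 z = 1"
  by (simp_all add: rat_eval_def)

lemma rat_eval_add [simp]: "rat_eval (p + q) z = rat_eval p z + rat_eval q z"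
proof -
  have "map_poly of_rat (p + q) = (map_poly of_rat p + map_poly of_rat q :: complex poly)"
    by (intro poly_eqI) (simp add: coeff_map_poly of_rat_add)
  then show ?thesis by (simp add: rat_eval_def)
qed

lemma rat_eval_smult [simp]: "rat_eval (smult a p) z = of_rat a * rat_eval p z"
  by (induction p) (simp_all add: of_rat_mult algebra_simps)

lemma rat_eval_mult [simp]: "rat_eval (p * q) z = rat_eval p z * rat_eval q z"
  by (induction p) (simp_all add: algebra_simps)

lemma rat_eval_diff [simp]: "rat_eval (p - q) z = rat_eval p z - rat_eval q z"
  using rat_eval_add[of "p - q" q z] by simp

lemma rat_eval_horner:
  "rat_eval (horner (\<lambda>i. of_int (c i)) n) z = poly (horner (\<lambda>i. of_int (c i)) n) z"
  by (induction n) simp_all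

lemma min_poly_dvd:
  assumes "is_min_poly p x" "rat_eval q x = 0"
  shows "p dvd q"
proof -
  have p: "p \<noteq> 0" "rat_eval p x = 0" using assms(1) by (auto simp: is_min_poly_def rat_root_iff)
  have "rat_eval (q div p * p + q mod p) x = rat_eval (q mod p) x"
    unfolding rat_eval_add rat_eval_mult by (simp add: p(2))
  then have "rat_eval (q mod p) x = 0" using assms(2) by (simp only: div_mult_mod_eq)
  moreover have "q mod p = 0 \<or> degree (q mod p) < degree p"
    using degree_mod_less[OF p(1)] .
  ultimately have "q mod p = 0"
    using assms(1) unfolding is_min_poly_def rat_root_iff by (meson not_less)
  then show ?thesis by auto
qed

lemma min_poly_exists:
  assumes "q \<noteq> 0" "rat_eval q x = 0"
  shows "\<exists>p. is_min_poly p x"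
proof -
  define p where "p = arg_min degree (\<lambda>q. q \<noteq> 0 \<and> rat_eval q x = 0)"
  have p: "p \<noteq> 0" "rat_eval p x = 0"
    using arg_min_natI[of "\<lambda>q. q \<noteq> 0 \<and> rat_eval q x = 0" q degree] assms
    by (auto simp: p_def)
  have least: "degree p \<le> degree r" if "r \<noteq> 0" "rat_eval r x = 0" for r
    using arg_min_nat_le[of "\<lambda>q. q \<noteq> 0 \<and> rat_eval q x = 0" r degree] that
    by (auto simp: p_def)
  have "is_min_poly (smult (inverse (lead_coeff p)) p) x"
    using p least by (auto simp: is_min_poly_def rat_root_iff)
  then show ?thesis ..
qed

section \<open>Irreducibility over the rationals by Eisenstein's criterion at 2\<close>

text \<open>If both factors had positive degree, exactly one of them would have an even constant
  term, as 4 does not divide that of \<open>P\<close>. The lowest odd coefficient of this factor, at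
  an index below \<open>degree P\<close>, would then produce an odd coefficient of
  \<open>P\<close>.\<close>

lemma eisenstein_even:
  fixes A B P :: "int poly"
  assumes P: "P = A * B" and monic: "lead_coeff P = 1"
    and even_coeff: "\<And>i. i < degree P \<Longrightarrow> even (coeff P i)"
    and const: "\<not> 4 dvd coeff P 0"
  shows "degree A = 0 \<or> degree B = 0"
proof (rule ccontr)
  assume neg: "\<not> ?thesis"
  have nz: "A \<noteq> 0" "B \<noteq> 0" using P monic by auto
  have degP: "degree P = degree A + degree B" using P nz by (simp add: degree_mult_eq)
  have c0: "coeff P 0 = coeff A 0 * coeff B 0" by (simp add: P coeff_mult_0)
  have lead: "lead_coeff A * lead_coeff B = 1" using P monic by (simp add: lead_coeff_mult)
  \<comment> \<open>Stated for an arbitrary pair, since either factor may be the one with even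
    constant term.\<close>
  have False
    if P: "P = A * B" and A: "even (coeff A 0)" "degree A < degree P" and B: "odd (coeff B 0)"
      and lead: "lead_coeff A * lead_coeff B = 1" for A B :: "int poly"
  proof -
    define k where "k = (LEAST i. odd (coeff A i))"
    have "odd (lead_coeff A)" using lead by (metis dvd_mult2 odd_one)
    then have k: "odd (coeff A k)" "k \<le> degree A"
      unfolding k_def by (rule LeastI, rule Least_le)
    have less: "even (coeff A i)" if "i < k" for i
      using not_less_Least that unfolding k_def by blast
    have "coeff P k = (\<Sum>i\<le>k. coeff A i * coeff B (k - i))" by (simp add: P coeff_mult)
    also have "\<dots> = (\<Sum>i<k. coeff A i * coeff B (k - i)) + coeff A k * coeff B 0"
      by (simp add: lessThan_Suc_atMost[symmetric])
    finally have "coeff P k = (\<Sum>i<k. coeff A i * coeff B (k - i)) + coeff A k * coeff B 0" .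
    moreover have "even (\<Sum>i<k. coeff A i * coeff B (k - i))"
      by (intro dvd_sum) (simp add: less)
    moreover have "even (coeff P k)" using even_coeff k(2) A(2) by simp
    ultimately show False using k(1) B by simp
  qed
  note key = this
  have "even (coeff P 0)" using even_coeff degP neg by simp
  then have "even (coeff A 0) \<or> even (coeff B 0)" by (simp add: c0)
  moreover have "\<not> (even (coeff A 0) \<and> even (coeff B 0))"
    using const c0 by (metis mult_dvd_mono mult_2_right one_add_one numeral_Bit0)
  ultimately show False
    using key[of A B] key[of B A] P degP neg lead by (auto simp: mult.commute)
qed

lemma clear_denominators:
  fixes p :: "rat poly"
  obtains a :: int and A :: "int poly"
  where "a \<noteq> 0" "smult (of_int a) p = map_poly of_int A"
proof -
  have "\<exists>a A. a \<noteq> 0 \<and> smult (of_int a) p = map_poly of_int A"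
  proof (induction p)
    case 0
    show ?case by (intro exI[of _ 1] exI[of _ 0]) simp
  next
    case (pCons c p)
    then obtain a A where a: "a \<noteq> 0" "smult (of_int a) p = map_poly of_int A" by blast
    obtain u v where c: "c = of_int u / of_int v" "v \<noteq> 0"
      by (metis Rat_cases_nonzero Fract_of_int_quotient div_0 div_by_1 of_int_0 of_int_1 zero_neq_one less_irrefl)
    have "smult (of_int (a * v)) (pCons c p) =
        pCons (of_int (a * u)) (smult (of_int v) (smult (of_int a) p))"
      using c(2) by (simp add: c(1) mult.commute)
    also have "\<dots> = map_poly of_int (pCons (a * u) (smult v A))"
      unfolding a(2) by (simp add: map_poly_pCons map_poly_smult)
    finally have "smult (of_int (a * v)) (pCons c p) =
      map_poly of_int (pCons (a * u) (smult v A))" .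
    moreover have "a * v \<noteq> 0" using a(1) c(2) by simp
    ultimately show ?case by blast
  qed
  then show ?thesis using that by blast
qed

lemma int_poly_hom:
  "map_poly of_int (A * B) = (map_poly of_int A * map_poly of_int B :: rat poly)"
  by (intro poly_eqI) (simp add: coeff_map_poly coeff_mult)

lemma degree_of_int_poly [simp]:
  "degree (map_poly of_int A :: rat poly) = degree A"
  by (cases "A = 0") (auto intro: map_poly_degree_eq)

text \<open>Gauss's lemma: the rational factorization of \<open>P\<close> by the minimal polynomial
  \<open>p\<close> becomes an integral one, with the same degrees, on passing to primitive parts. As
  \<open>p\<close> is not constant, Eisenstein forces the cofactor to be.\<close>

lemma min_poly_eisenstein_even:
  fixes P :: "int poly" and x :: complex
  assumes monic: "lead_coeff P = 1"
    and even_coeff: "\<And>i. i < degree P \<Longrightarrow> even (coeff P i)"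
    and const: "\<not> 4 dvd coeff P 0"
    and root: "rat_eval (map_poly of_int P) x = 0"
  shows "is_min_poly (map_poly of_int P) x"
proof -
  let ?P = "map_poly of_int P :: rat poly"
  have P0: "?P \<noteq> 0" using monic by (metis degree_of_int_poly coeff_map_poly of_int_0 of_int_1 coeff_0 zero_neq_one)
  obtain p where p: "is_min_poly p x" using min_poly_exists[OF P0 root] by blast
  then have p0: "p \<noteq> 0" "rat_eval p x = 0" by (auto simp: is_min_poly_def rat_root_iff)
  obtain h where h: "?P = p * h" using min_poly_dvd[OF p root] by (elim dvdE)
  obtain a A where a: "a \<noteq> 0" "smult (of_int a) p = map_poly of_int A" by (rule clear_denominators)
  obtain b B where b: "b \<noteq> 0" "smult (of_int b) h = map_poly of_int B" by (rule clear_denominators)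
  have h0: "h \<noteq> 0" using P0 h by auto
  have "map_poly of_int (smult (a * b) P) = (smult (of_int (a * b)) ?P :: rat poly)"
    by (simp add: map_poly_smult)
  also have "\<dots> = smult (of_int a) p * smult (of_int b) h" by (simp add: h mult.commute)
  also have "\<dots> = map_poly of_int (A * B)" by (simp only: a b int_poly_hom)
  finally have eq: "map_poly of_int (smult (a * b) P) = (map_poly of_int (A * B) :: rat poly)" .
  have "coeff (smult (a * b) P) n = coeff (A * B) n" for n
    using arg_cong[OF eq, of "\<lambda>p. coeff p n"] by (simp only: coeff_map_poly of_int_0 of_int_eq_iff)
  then have "smult (a * b) P = A * B" by (rule poly_eqI)
  then have "primitive_part (smult (a * b) P) = primitive_part A * primitive_part B"
    by (simp add: primitive_part_mult)
  moreover have "content P = 1"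
  proof -
    have "content P dvd 1" using content_dvd_coeff[of P "degree P"] monic by metis
    then show ?thesis by (metis is_unit_normalize normalize_content)
  qed
  ultimately have "smult (sgn (a * b)) P = primitive_part A * primitive_part B"
    by (simp add: primitive_part_smult primitive_part_prim)
  moreover have "sgn (a * b) = 1 \<or> sgn (a * b) = -1" using a(1) b(1) by (auto simp: sgn_if)
  ultimately have "P = smult (sgn (a * b)) (primitive_part A) * primitive_part B" by auto
  from eisenstein_even[OF this monic even_coeff const]
  have "degree A = 0 \<or> degree B = 0" using a(1) b(1) by (simp add: sgn_eq_0_iff)
  moreover have "degree A = degree p" using a by (metis degree_of_int_poly degree_smult_eq of_int_eq_0_iff)
  moreover have "degree B = degree h" using b by (metis degree_of_int_poly degree_smult_eq of_int_eq_0_iff)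
  moreover have "degree p \<noteq> 0"
  proof
    assume "degree p = 0"
    then obtain c where "p = [:c:]" by (auto elim: degree_eq_zeroE)
    then show False using p0 by simp
  qed
  ultimately have "degree h = 0" by simp
  then have "degree ?P = degree p" unfolding h using p0 h0 by (simp add: degree_mult_eq)
  then show ?thesis
    using p root monic by (auto simp: is_min_poly_def rat_root_iff coeff_map_poly)
qed

text \<open>The value at \<open>z0\<close> is the product of the differences z0 - x over all roots
  x; if each has norm at least \<open>e\<close>, the product has norm at least
  \<open>e ^ degree Q\<close>.\<close>

lemma near_root:
  fixes Q :: "complex poly"
  assumes "lead_coeff Q = 1" "degree Q > 0" "0 < e" "norm (poly Q z0) < e ^ degree Q"
  shows "\<exists>z. poly Q z = 0 \<and> dist z z0 < e"
proof (rule ccontr)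
  assume neg: "\<not> ?thesis"
  obtain S where S: "size S = degree Q" "Q = (\<Prod>x\<in>#S. [:-x, 1:])"
    using alg_closed_imp_factorization[of Q] assms(1) by force
  have root: "poly Q x = 0" if "x \<in># S" for x
    unfolding S(2) poly_prod_mset using that by (auto simp: prod_mset_zero_iff)
  \<comment> \<open>Induction over submultisets of \<open>S\<close>, so that every element is still
    known to be a root of \<open>Q\<close>.\<close>
  have "e ^ size T \<le> norm (poly (\<Prod>x\<in>#T. [:-x, 1:]) z0)" if "T \<subseteq># S" for T
    using that
  proof (induction T)
    case (add x T)
    then have "x \<in># S" "T \<subseteq># S"
      by (auto intro: mset_subset_eq_insertD dest: mset_subset_eqD mset_subset_eq_insertD subset_mset.less_imp_le)
    then have "e \<le> norm (z0 - x)" using neg root by (auto simp: dist_norm norm_minus_commute not_less)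
    moreover have "e ^ size T \<le> norm (poly (\<Prod>x\<in>#T. [:-x, 1:]) z0)" using add \<open>T \<subseteq># S\<close> by simp
    ultimately have "e * e ^ size T \<le> norm (z0 - x) * norm (poly (\<Prod>x\<in>#T. [:-x, 1:]) z0)"
      using assms(3) by (intro mult_mono) auto
    then show ?case by (simp add: norm_mult[symmetric] algebra_simps)
  qed simp
  from this[of S] show False using S assms(4) by simp
qed

section \<open>Conjugates outside the unit disc\<close>

text \<open>The minimal polynomial of \<beta> divides \<open>p - q\<close>. Hence coincidences
  between orbit points, written as polynomials in \<beta>, carry over to the conjugate.\<close>

lemma galois_conjugate_eq:
  assumes "z \<in> galois_conjugates \<beta>" "rat_eval p (of_real \<beta>) = rat_eval q (of_real \<beta>)"
  shows "rat_eval p z = rat_eval q z"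
proof -
  obtain r where r: "is_min_poly r (of_real \<beta>)" "rat_eval r z = 0"
    using assms(1) by (auto simp: galois_conjugates_def rat_root_iff)
  have "rat_eval (p - q) (of_real \<beta>) = 0" using assms(2) by simp
  then obtain h where "p - q = r * h" using min_poly_dvd[OF r(1)] by (blast elim: dvdE)
  then have "rat_eval (p - q) z = 0" using r(2) by simp
  then show ?thesis by simp
qed

lemma inverse_conjugate_in_\<G>:
  assumes "z \<in> \<Omega>" "norm z > 1"
  shows "inverse z \<in> \<G>"
proof -
  obtain \<beta> where \<beta>: "gen_parry_number \<beta>" and z: "z \<in> galois_conjugates \<beta>"
    using assms(1) by (auto simp: \<Omega>_def)
  obtain m E where m: "m \<ge> 1" "\<beta> \<in> {real m<..real m + 1}" and pcf: "PCF m \<beta> E"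
    using \<beta> by (auto simp: gen_parry_number_def)
  define x where "x n = (gen_beta_map m \<beta> E ^^ n) 1" for n
  define k where "k n = beta_branch m \<beta> (x n)" for n
  \<comment> \<open>\<open>s n\<close> is the sign of the slope of the n-th iterate along the orbit;
    with it, increasing and decreasing branches share the recursion \<open>y_Suc\<close> with
    integer digits.\<close>
  define s :: "nat \<Rightarrow> int" where
    "s = rec_nat 1 (\<lambda>n r. if E (k n) = 1 then r else - r)"
  define c where "c n = - s n * (if E (k n) = 1 then int (k n) else int (k n) + 1)" for n
  define y where "y n = of_int (s n) * x n" for n
  define p :: "nat \<Rightarrow> rat poly" where "p n = horner (\<lambda>i. of_int (c i)) n" for n
  define w where "w = inverse z"
  have s_Suc: "s (Suc n) = (if E (k n) = 1 then s n else - s n)" for n by (simp add: s_def)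
  have s: "s n = 1 \<or> s n = -1" for n by (induction n) (auto simp: s_Suc, simp_all add: s_def)
  have x01: "x n \<in> {0..1}" for n
  proof (induction n)
    case (Suc n)
    then show ?case using gen_beta_map_mem[OF m, of "x n" E] by (simp add: x_def)
  qed (simp add: x_def)
  have y_Suc: "y (Suc n) = \<beta> * y n + of_int (c n)" for n
    by (simp add: y_def x_def s_Suc c_def k_def gen_beta_map_def Let_def algebra_simps)
  have p\<beta>: "rat_eval (p n) (of_real \<beta>) = of_real (y n)" for n
  proof (induction n)
    case 0
    show ?case by (simp add: p_def y_def x_def s_def)
  next
    case (Suc n)
    then show ?case by (simp add: p_def y_Suc)
  qed
  have y_cases: "y n \<in> range x \<union> uminus ` range x" for n using s[of n] by (auto simp: y_def)
  have "range x = {(gen_beta_map m \<beta> E ^^ j) 1 | j. True}" by (auto simp: x_def)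
  then have "finite (range x)" using pcf by (simp add: PCF_def)
  then have "finite (range y)" using y_cases
    by (intro finite_subset[of "range y" "range x \<union> uminus ` range x"]) auto
  \<comment> \<open>The representative index depends only on the value \<open>y n\<close>, so the
    values at \<open>z\<close> are at most as many as those of \<open>y\<close>.\<close>
  moreover have "rat_eval (p n) z = rat_eval (p (SOME l. y l = y n)) z" for n
    by (rule galois_conjugate_eq[OF z]) (simp add: p\<beta> someI[of "\<lambda>l. y l = y n" n])
  then have "range (\<lambda>n. rat_eval (p n) z) \<subseteq> (\<lambda>v. rat_eval (p (SOME l. y l = v)) z) ` range y"
    by auto
  ultimately have "finite (range (\<lambda>n. rat_eval (p n) z))" using finite_surj by blast
  then obtain C where C: "norm (rat_eval (p n) z) \<le> C" for n
    using finite_imp_bounded by (fastforce simp: bounded_iff)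
  have z0: "z \<noteq> 0" and w1: "norm w < 1" using assms(2)
    by (auto simp: w_def norm_inverse inverse_less_1_iff)
  \<comment> \<open>Telescoping: the digit cancels in the difference of the recursions at
    \<open>z\<close> and \<beta>. The right-hand side tends to 0 because the values at
    \<open>z\<close> are bounded.\<close>
  have partial: "(1 - of_real \<beta> * w) * (\<Sum>n<K. of_real (y n) * w ^ n) =
      (rat_eval (p K) z - of_real (y K)) * w ^ K" for K
  proof (induction K)
    case 0
    show ?case by (simp add: p_def y_def x_def s_def)
  next
    case (Suc K)
    have "(1 - of_real \<beta> * w) * (\<Sum>n<Suc K. of_real (y n) * w ^ n) =
      (rat_eval (p K) z - of_real (y K)) * w ^ K + (1 - of_real \<beta> * w) * (of_real (y K) * w ^ K)"
      by (simp only: sum.lessThan_Suc distrib_left Suc)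
    also have "\<dots> = (z * rat_eval (p K) z - of_real \<beta> * of_real (y K)) * w ^ Suc K"
      using z0 by (simp add: w_def field_simps)
    also have "\<dots> = (rat_eval (p (Suc K)) z - of_real (y (Suc K))) * w ^ Suc K"
      by (simp add: p_def y_Suc)
    finally show ?case .
  qed
  have y1: "\<bar>y n\<bar> \<le> 1" for n using s[of n] x01[of n] by (auto simp: y_def)
  have "norm (rat_eval (p n) z - of_real (y n)) \<le> C + 1" for n
    using norm_triangle_ineq4[of "rat_eval (p n) z" "of_real (y n)"] C[of n] y1[of n] by simp
  then have "(\<lambda>K. (rat_eval (p K) z - of_real (y K)) * w ^ K) \<longlonglongrightarrow> 0"
    using w1 by (intro lim_null_mult_left_bounded[where B="C + 1"] LIMSEQ_power_zero) auto
  then have "(\<lambda>K. (1 - of_real \<beta> * w) * (\<Sum>n<K. of_real (y n) * w ^ n)) \<longlonglongrightarrow> 0"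
    by (simp only: partial)
  moreover have "1 - of_real \<beta> * w \<noteq> 0"
    using z z0 by (auto simp: w_def galois_conjugates_def field_simps)
  ultimately have "(\<lambda>n. of_real (y n) * w ^ n) sums 0"
    using tendsto_mult_left[of _ 0 sequentially "inverse (1 - of_real \<beta> * w)"]
    by (fastforce simp: sums_def mult.assoc[symmetric])
  then have "(\<lambda>n. of_real (y (Suc n)) * w ^ Suc n) sums (- 1)"
    by (subst sums_Suc_iff) (simp add: y_def x_def s_def)
  then have "1 + (\<Sum>j. of_real (y (Suc j)) * w ^ Suc j) = 0"
    by (simp add: sums_iff)
  moreover have "\<forall>j\<ge>1. y j \<in> {-1..1}" using y1 by (auto simp: abs_le_iff minus_le_iff)
  then have "(\<lambda>w. 1 + (\<Sum>j. of_real (y (Suc j)) * w ^ Suc j)) \<in> \<F>"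
    unfolding \<F>_def by blast
  ultimately show ?thesis using w1 by (auto simp: \<G>_def w_def[symmetric])
qed

section \<open>Closedness of the right-hand side\<close>

text \<open>The set is a projection of the zero set of the series, viewed as a function of both the
  point and the coefficient sequence. This function is continuous on a compact product by the
  Weierstrass test.\<close>

lemma compact_\<G>_Int_cball:
  assumes "r < 1"
  shows "compact (\<G> \<inter> cball 0 r)"
proof -
  define S where "S = cball (0::complex) r \<times> (PiE UNIV (\<lambda>_. {-1..1}) :: (nat \<Rightarrow> real) set)"
  define f where "f N v = 1 + (\<Sum>j<N. complex_of_real (snd v j) * fst v ^ Suc j)"
    for N and v :: "complex \<times> (nat \<Rightarrow> real)"
  define g where "g v = 1 + (\<Sum>j. complex_of_real (snd v j) * fst v ^ Suc j)"
    for v :: "complex \<times> (nat \<Rightarrow> real)"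
  have "compactin (product_topology (\<lambda>_. euclidean) UNIV) (PiE UNIV (\<lambda>_. {-1..1}) :: (nat \<Rightarrow> real) set)"
    by (simp add: compactin_PiE)
  then have "compact (PiE UNIV (\<lambda>_. {-1..1}) :: (nat \<Rightarrow> real) set)"
    by (simp add: euclidean_product_topology)
  then have S: "compact S" unfolding S_def by (intro compact_Times compact_cball)
  have bound: "norm (complex_of_real (snd v j) * fst v ^ Suc j) \<le> r ^ Suc j" if "v \<in> S" for v j
  proof -
    have "\<bar>snd v j\<bar> \<le> 1" "norm (fst v) \<le> r" using that by (auto simp: S_def PiE_iff abs_le_iff minus_le_iff)
    then have "\<bar>snd v j\<bar> * norm (fst v) ^ Suc j \<le> 1 * r ^ Suc j"
      by (intro mult_mono power_mono) auto
    then show ?thesis by (simp add: norm_mult norm_power)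
  qed
  \<comment> \<open>For negative \<open>r\<close> the disc is empty and uniform convergence is
    vacuous; the geometric majorant serves \<open>0 \<le> r\<close>.\<close>
  have "S = {} \<or> 0 \<le> r" by (auto simp: S_def intro: order_trans[OF norm_ge_zero])
  have "uniform_limit S (\<lambda>N v. \<Sum>j<N. complex_of_real (snd v j) * fst v ^ Suc j)
      (\<lambda>v. \<Sum>j. complex_of_real (snd v j) * fst v ^ Suc j) sequentially" (is ?u)
  proof (cases "0 \<le> r")
    case True
    then have "summable (\<lambda>j. r ^ Suc j)" using assms
      by (simp add: summable_geometric summable_mult)
    then show ?thesis by (intro Weierstrass_m_test[where M = "\<lambda>j. r ^ Suc j"] bound)
  next
    case False
    then show ?thesis using \<open>S = {} \<or> 0 \<le> r\<close> by simp
  qed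
  then have ul: "uniform_limit S f g sequentially"
    unfolding f_def g_def by (intro uniform_limit_intros)
  have "continuous_on S (f N)" for N
    unfolding f_def
    by (intro continuous_intros continuous_on_product_then_coordinatewise[of S snd])
  then have "continuous_on S g"
    by (intro uniform_limit_theorem[OF _ ul]) auto
  then have "compact (S \<inter> g -` {0})"
    using S continuous_closed_preimage[of S g "{0}"] compact_imp_closed[OF S]
    by (metis closed_singleton compact_Int_closed inf_left_idem)
  then have "compact (fst ` (S \<inter> g -` {0}))"
    by (intro compact_continuous_image continuous_intros)
  also have "fst ` (S \<inter> g -` {0}) = \<G> \<inter> cball 0 r"
  proof safe
    fix w a assume w: "(w, a) \<in> S" and g0: "g (w, a) = 0"
    then show "fst (w, a) \<in> cball 0 r" by (auto simp: S_def)
    then have "w \<in> ball 0 1" using assms by simp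
    \<comment> \<open>Sequences in \<open>S\<close> start at index 0 and coefficients in \<F> at
      index 1, hence the shift to \<open>a (j - 1)\<close>.\<close>
    moreover have "(\<lambda>w. 1 + (\<Sum>j. of_real (a j) * w ^ Suc j)) \<in> \<F>"
      using w by (auto simp: \<F>_def S_def PiE_iff intro!: exI[of _ "\<lambda>j. a (j - 1)"])
    ultimately show "fst (w, a) \<in> \<G>" using g0 by (auto simp: \<G>_def g_def)
  next
    fix w assume w: "w \<in> \<G>" "w \<in> cball 0 r"
    then obtain a :: "nat \<Rightarrow> real" where a: "\<forall>j\<ge>1. a j \<in> {-1..1}"
      "1 + (\<Sum>j. of_real (a (Suc j)) * w ^ Suc j) = 0"
      by (auto simp: \<G>_def \<F>_def)
    then have "(w, \<lambda>j. a (Suc j)) \<in> S \<inter> g -` {0}" using w by (auto simp: S_def g_def)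
    then show "w \<in> fst ` (S \<inter> g -` {0})" by force
  qed
  finally show ?thesis .
qed

lemma closed_cball_Un_inverse_\<G>: "closed (cball 0 1 \<union> {z. norm z > 1 \<and> inverse z \<in> \<G>})"
  unfolding closed_sequential_limits
proof (intro allI impI, elim conjE)
  fix u l assume u: "\<forall>n. u n \<in> cball 0 1 \<union> {z. norm z > 1 \<and> inverse z \<in> \<G>}" and lim: "u \<longlonglongrightarrow> l"
  show "l \<in> cball 0 1 \<union> {z. norm z > 1 \<and> inverse z \<in> \<G>}"
  proof (cases "norm l \<le> 1")
    case False
    \<comment> \<open>The margin \<open>R\<close> keeps the inverses eventually in a disc of radius
      below 1, where compactness is available.\<close>
    then obtain R where R: "1 < R" "R < norm l" using dense[of 1 "norm l"] by auto
    have ev: "\<forall>\<^sub>F n in sequentially. R < norm (u n)"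
      using order_tendstoD(1)[OF tendsto_norm[OF lim] R(2)] .
    have "\<forall>\<^sub>F n in sequentially. inverse (u n) \<in> \<G> \<inter> cball 0 (inverse R)"
      using ev
    proof eventually_elim
      case (elim n)
      then have "1 < norm (u n)" using R by simp
      then have "inverse (u n) \<in> \<G>" using u[rule_format, of n] by auto
      then show ?case using elim R by (simp add: norm_inverse le_imp_inverse_le)
    qed
    moreover have "l \<noteq> 0" using R by auto
    then have "(\<lambda>n. inverse (u n)) \<longlonglongrightarrow> inverse l" by (rule tendsto_inverse[OF lim])
    moreover have "closed (\<G> \<inter> cball 0 (inverse R))"
      using R by (intro compact_imp_closed compact_\<G>_Int_cball) (simp add: inverse_less_1_iff)
    ultimately have "inverse l \<in> \<G> \<inter> cball 0 (inverse R)"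
      using Lim_in_closed_set[of "\<G> \<inter> cball 0 (inverse R)" "\<lambda>n. inverse (u n)" sequentially] by simp
    then show ?thesis using False by simp
  qed simp
qed

section \<open>Realizing prescribed orbits\<close>

text \<open>
  The signed orbit ends at the fixed point 0 of the branch \<open>k = 0\<close>; for the last step, where
  \<open>\<beta> * \<bar>y n\<bar>\<close> is an integer, the branch must be decreasing, as the branch intervals are
  closed on the right.
\<close>

lemma gen_parry_numberI:
  fixes y :: "nat \<Rightarrow> real" and d :: "nat \<Rightarrow> int"
  assumes \<beta>: "\<beta> > 2" and y0: "y 0 = 1"
    and rec: "\<And>j. j \<le> n \<Longrightarrow> y (Suc j) = \<beta> * y j - of_int (d j)"
    and last: "y (Suc n) = 0"
    and less1: "\<And>j. j \<in> {1..n} \<Longrightarrow> \<bar>y j\<bar> < 1"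
    and gt: "\<And>j. j \<le> n \<Longrightarrow> \<beta> * \<bar>y j\<bar> > 1"
    and gap: "\<And>i j. i \<le> n \<Longrightarrow> j \<le> n \<Longrightarrow> i \<noteq> j \<Longrightarrow> \<beta> * \<bar>\<bar>y i\<bar> - \<bar>y j\<bar>\<bar> > 1"
  shows "gen_parry_number \<beta>"
proof -
  define m where "m = nat (\<lceil>\<beta>\<rceil> - 1)"
  have m: "m \<ge> 1" "\<beta> \<in> {real m<..real m + 1}"
    using \<beta> unfolding m_def greaterThanAtMost_iff by linarith+
  define k where "k j = nat (\<lceil>\<beta> * \<bar>y j\<bar>\<rceil> - 1)" for j
  \<comment> \<open>A visited branch is decreasing exactly when the next signed point changes sign
    or is 0. This is consistent because distinct times visit distinct branches
    (\<open>k_inj\<close>).\<close>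
  define E :: "nat \<Rightarrow> int" where
    "E l = (if \<exists>j\<le>n. l = k j \<and> sgn (y j) * y (Suc j) \<le> 0 then -1 else 1)" for l
  define f where "f = gen_beta_map m \<beta> E"
  have k_bounds: "real (k j) < \<beta> * \<bar>y j\<bar>" "\<beta> * \<bar>y j\<bar> \<le> real (k j) + 1" "k j \<ge> 1" if "j \<le> n" for j
    using gt[OF that] unfolding k_def by linarith+
  have k_inj: "i = j" if "i \<le> n" "j \<le> n" "k i = k j" for i j
  proof (rule ccontr)
    assume "i \<noteq> j"
    then have "\<bar>\<beta> * \<bar>y i\<bar> - \<beta> * \<bar>y j\<bar>\<bar> > 1"
      using gap[of i j] that \<beta> by (simp add: abs_mult right_diff_distrib[symmetric])
    then show False using k_bounds[OF that(1)] k_bounds[OF that(2)] that(3) by linarith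
  qed
  have E_k: "E (k j) = (if sgn (y j) * y (Suc j) \<le> 0 then -1 else 1)" if "j \<le> n" for j
    using k_inj that unfolding E_def by metis
  \<comment> \<open>No \<open>k j\<close> is 0, so branch 0 keeps the sign 1 and fixes 0, where the
    orbit stays.\<close>
  have E_0: "E 0 = 1" using k_bounds(3) unfolding E_def by fastforce
  have le1: "\<bar>y j\<bar> \<le> 1" if "j \<le> n" for j using less1[of j] y0 that by (cases j) auto
  have step: "f \<bar>y j\<bar> = \<bar>y (Suc j)\<bar>" if j: "j \<le> n" for j
  proof -
    define u where "u = sgn (y j) * y (Suc j)"
    have y_ne: "y j \<noteq> 0" using gt[OF j] by auto
    have abs_u: "\<bar>u\<bar> = \<bar>y (Suc j)\<bar>" using y_ne by (simp add: u_def abs_mult)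
    have u1: "\<bar>u\<bar> < 1"
    proof (cases "j = n")
      case False
      then show ?thesis using less1[of "Suc j"] j abs_u by simp
    qed (simp add: abs_u last)
    \<comment> \<open>The digit relative to the sign of \<open>y j\<close>. As
      \<open>\<bar>u\<bar> < 1\<close>, the branch is D - 1 for \<open>u \<le> 0\<close> and D for
      \<open>u > 0\<close>.\<close>
    define D where "D = (if y j > 0 then d j else - d j)"
    have \<beta>y: "\<beta> * \<bar>y j\<bar> = of_int D + u"
      using rec[OF j] y_ne by (simp add: D_def u_def sgn_if abs_if)
    have ky: "k j \<le> m"
    proof -
      have "\<beta> * \<bar>y j\<bar> \<le> \<beta>" using le1[OF j] \<beta> by (simp add: mult_left_le)
      moreover have "\<beta> \<le> real m + 1" using m(2) by simp
      ultimately have "real (k j) < real m + 1" using k_bounds(1)[OF j] by linarith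
      then show ?thesis by simp
    qed
    have mem: "\<bar>y j\<bar> \<in> {0..1}" using le1[OF j] by simp
    have "\<bar>y j\<bar> \<in> beta_interval m \<beta> (k j)"
      using k_bounds[OF j] beta_interval_iff[OF m mem ky] by simp
    then have branch: "beta_branch m \<beta> \<bar>y j\<bar> = k j" by (intro beta_branch_eq[OF m mem ky])
    show ?thesis
    proof (cases "u \<le> 0")
      case True
      then have "real_of_int (int (k j)) < real_of_int D" "real_of_int D < real_of_int (int (k j) + 2)"
        using k_bounds[OF j] \<beta>y u1 by simp_all
      then have "int (k j) = D - 1" unfolding of_int_less_iff by linarith
      then have "real (k j) = of_int D - 1" by (metis of_int_diff of_int_1 of_int_of_nat_eq)
      then show ?thesis using True E_k[OF j] abs_u \<beta>y
        by (simp add: f_def gen_beta_map_def branch u_def[symmetric])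
    next
      case False
      then have "real_of_int (int (k j)) < real_of_int (D + 1)" "real_of_int D < real_of_int (int (k j) + 1)"
        using k_bounds[OF j] \<beta>y u1 by simp_all
      then have "int (k j) = D" unfolding of_int_less_iff by linarith
      then have "real (k j) = of_int D" by (metis of_int_of_nat_eq)
      then show ?thesis using False E_k[OF j] abs_u \<beta>y
        by (simp add: f_def gen_beta_map_def branch u_def[symmetric])
    qed
  qed
  have f0: "f 0 = 0"
  proof -
    have "beta_branch m \<beta> 0 = 0"
      using beta_interval_iff[OF m, of 0 0] by (intro beta_branch_eq[OF m]) auto
    then show ?thesis using E_0 by (simp add: f_def gen_beta_map_def)
  qed
  have orbit: "(f ^^ j) 1 = \<bar>y j\<bar>" if "j \<le> Suc n" for j
    using that by (induction j) (simp_all add: y0 step)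
  have tail: "(f ^^ (Suc n + j)) 1 = 0" for j
  proof (induction j)
    case 0
    show ?case using orbit[of "Suc n"] last by simp
  qed (simp add: f0)
  have "(f ^^ j) 1 \<in> insert 0 ((\<lambda>j. \<bar>y j\<bar>) ` {..Suc n})" for j
  proof (cases "j \<le> Suc n")
    case False
    then obtain l where "j = Suc n + l" using nat_le_linear le_Suc_ex by blast
    then show ?thesis using tail by simp
  qed (simp add: orbit)
  then have "{(f ^^ j) 1 | j. True} \<subseteq> insert 0 ((\<lambda>j. \<bar>y j\<bar>) ` {..Suc n})" by auto
  then have "PCF m \<beta> E" unfolding PCF_def f_def[symmetric] by (rule finite_subset) simp
  moreover have "E \<in> {..m} \<rightarrow> {1, -1}" by (simp add: E_def)
  ultimately show ?thesis using m \<beta> unfolding gen_parry_number_def by (intro conjI exI[of _ m]) auto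
qed

text \<open>Take integer digits \<open>d j\<close> near \<open>M * a j\<close> for a large
  \<open>M\<close>, and \<beta> near \<open>M\<close> as a root of the equation
  \<open>y (Suc n) = 0\<close>. Then \<open>y j = (d j + y (Suc j)) / \<beta>\<close> differs from
  \<open>a j\<close> by O(1 / \<beta>), too little to destroy the inequalities that
  \<open>gen_parry_numberI\<close> demands.\<close>

lemma realize_orbit:
  fixes a :: "nat \<Rightarrow> real"
  assumes a0: "a 0 = 1" and a: "\<And>j. j \<in> {1..n} \<Longrightarrow> 0 < \<bar>a j\<bar> \<and> \<bar>a j\<bar> < 1"
    and inj: "inj_on (\<lambda>j. \<bar>a j\<bar>) {..n}" and \<eta>: "\<eta> > 0"
  obtains \<beta> :: real and c :: "nat \<Rightarrow> int" and y :: "nat \<Rightarrow> real"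
  where "gen_parry_number \<beta>" "\<beta> > K"
    "\<And>j. y j = poly (horner (\<lambda>i. of_int (c i)) j) \<beta>" "y (Suc n) = 0"
    "\<And>j. j \<le> n \<Longrightarrow> \<bar>y j - a j\<bar> < \<eta>"
    "\<And>j. j \<le> n \<Longrightarrow> even (c j)" "\<not> 4 dvd c n"
proof -
  \<comment> \<open>All margins that must survive the error: distances of the
    \<open>\<bar>a j\<bar>\<close> from 1, from 0 and from each other, and \<eta>. Their minimum is
    \<delta>.\<close>
  define S where "S = insert 1 (insert \<eta> ((\<lambda>j. 1 - \<bar>a j\<bar>) ` {1..n} \<union> (\<lambda>j. \<bar>a j\<bar>) ` {..n} \<union>
    (\<lambda>(i, j). \<bar>\<bar>a i\<bar> - \<bar>a j\<bar>\<bar>) ` ({..n} \<times> {..n} - Id)))"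
  have abs_pos: "0 < \<bar>a j\<bar>" "\<bar>a j\<bar> \<le> 1" if "j \<le> n" for j
    using a[of j] a0 that by (cases "j = 0"; force)+
  have "finite S" "S \<noteq> {}" by (auto simp: S_def)
  moreover have "\<forall>s\<in>S. 0 < s"
    using a abs_pos \<eta> inj by (auto simp: S_def inj_on_def)
  ultimately obtain \<delta> where \<delta>: "\<delta> > 0" "\<And>s. s \<in> S \<Longrightarrow> \<delta> \<le> s"
    using Min_in[of S] Min_le[of S] by metis
  have \<delta>_le: "\<delta> \<le> 1" "\<delta> \<le> \<eta>" "\<And>j. j \<in> {1..n} \<Longrightarrow> \<delta> \<le> 1 - \<bar>a j\<bar>" "\<And>j. j \<le> n \<Longrightarrow> \<delta> \<le> \<bar>a j\<bar>"
    "\<And>i j. i \<le> n \<Longrightarrow> j \<le> n \<Longrightarrow> i \<noteq> j \<Longrightarrow> \<delta> \<le> \<bar>\<bar>a i\<bar> - \<bar>a j\<bar>\<bar>"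
    by (rule \<delta>(2), force simp: S_def)+
  obtain N :: nat where N: "real N > 20 / \<delta> + \<bar>K\<bar>" using reals_Archimedean2 by blast
  \<comment> \<open>For n = 0 the digit \<open>M\<close> is also the last one and must be 2 modulo
    4; otherwise it is enough that it is even.\<close>
  define M :: int where "M = (if n = 0 then 4 * int N + 2 else 2 * int N + 4)"
  have "20 / \<delta> > 0" using \<delta>(1) by simp
  moreover have "of_int M - 2 \<ge> 2 * real N" by (simp add: M_def)
  ultimately have M: "of_int M - 2 > 20 / \<delta>" "of_int M - 2 > K" using N by linarith+
  have "20 / \<delta> \<ge> 20" using \<delta>(1) \<delta>_le(1) by (simp add: field_simps)
  then have M22: "of_int M > (22::real)" using M by simp
  have evenM: "even M" by (simp add: M_def)
  \<comment> \<open>Any digits within a bounded distance of \<open>M * a j\<close> work, since \<open>y j = d j / \<beta> + O(1 / \<beta>)\<close>.\<close>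
  define d where "d j = (if j = 0 then M else 4 * round ((of_int M * a j - 2) / 4) + 2)" for j
  have d_0: "d 0 = M" by (simp add: d_def)
  have d_even: "even (d j)" for j using evenM by (simp add: d_def)
  have d_n: "\<not> 4 dvd d n" by (simp add: d_def M_def) presburger
  have d_near: "\<bar>of_int (d j) - of_int M * a j\<bar> \<le> 2" for j
  proof (cases "j = 0")
    case False
    let ?t = "(of_int M * a j - 2) / 4"
    define r where "r = of_int (round ?t) - ?t"
    have "of_int (d j) - of_int M * a j = 4 * r"
      using False by (simp add: d_def r_def field_simps)
    moreover have "\<bar>r\<bar> \<le> 1 / 2" unfolding r_def by (rule of_int_round_abs_le)
    ultimately show ?thesis by linarith
  qed (simp add: d_def a0)
  have d_le: "\<bar>of_int (d j)\<bar> \<le> (of_int M :: real)" if "j \<le> n" for j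
  proof (cases "j = 0")
    case True
    then show ?thesis using M22 by (simp add: d_def)
  next
    case False
    have "20 < (of_int M - 2) * \<delta>" using M(1) \<delta>(1) by (simp add: field_simps)
    also have "\<dots> \<le> of_int M * (1 - \<bar>a j\<bar>)"
      using \<delta>(1) \<delta>_le(3)[of j] M22 False that by (intro mult_mono) auto
    finally have "of_int M * \<bar>a j\<bar> + 2 \<le> of_int M" by (simp add: algebra_simps)
    moreover have "\<bar>of_int M * a j\<bar> = of_int M * \<bar>a j\<bar>" using M22 by (simp add: abs_mult)
    ultimately show ?thesis using d_near[of j] by linarith
  qed
  define P :: "real poly" where "P = horner (\<lambda>i. of_int (- d i)) (Suc n)"
  have poly_P: "\<bar>poly P x - x ^ n * (x - of_int M)\<bar> \<le> of_int M * x ^ n / (x - 1)" if "x > 1" for x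
  proof -
    have "poly P x - x ^ n * (x - of_int M) = - (\<Sum>i<n. of_int (d (Suc i)) * x ^ (n - Suc i))"
      unfolding P_def poly_horner sum.lessThan_Suc_shift by (simp add: d_0 sum_negf algebra_simps)
    also have "\<bar>\<dots>\<bar> \<le> (\<Sum>i<n. \<bar>of_int (d (Suc i)) * x ^ (n - Suc i)\<bar>)"
      by (simp only: abs_minus_cancel sum_abs)
    also have "\<dots> \<le> (\<Sum>i<n. of_int M * x ^ (n - Suc i))"
      using that d_le by (intro sum_mono) (simp add: abs_mult mult_right_mono)
    also have "\<dots> = of_int M * (\<Sum>i<n. x ^ i)"
      by (simp add: sum_distrib_left[symmetric] sum.nat_diff_reindex)
    also have "\<dots> = of_int M * ((x ^ n - 1) / (x - 1))" using that by (subst geometric_sum) auto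
    also have "\<dots> \<le> of_int M * (x ^ n / (x - 1))"
      using that M22 by (intro mult_left_mono divide_right_mono) auto
    finally show ?thesis by simp
  qed
  \<comment> \<open>The main term \<open>x ^ n * (x - M)\<close> is \<open>- 2 * x ^ n\<close> at M
    - 2 and \<open>x ^ n\<close> at M + 1; by \<open>poly_P\<close> the error is at most
    \<open>2 * x ^ n\<close> and \<open>x ^ n\<close> there.\<close>
  have "\<exists>\<beta>. of_int M - 2 \<le> \<beta> \<and> \<beta> \<le> of_int M + 1 \<and> poly P \<beta> = 0"
  proof (rule IVT)
    let ?x = "of_int M - 2 :: real"
    have "of_int M * ?x ^ n / (?x - 1) \<le> 2 * ?x ^ n"
      using M22 by (simp add: divide_simps)
    moreover have "?x ^ n * (?x - of_int M) = - 2 * ?x ^ n" by simp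
    ultimately show "poly P (of_int M - 2) \<le> 0" using poly_P[of ?x] M22 by linarith
    let ?x = "of_int M + 1 :: real"
    have "\<bar>poly P ?x - ?x ^ n\<bar> \<le> ?x ^ n" using poly_P[of ?x] M22 by simp
    then show "0 \<le> poly P (of_int M + 1)" by linarith
  qed auto
  then obtain \<beta> where \<beta>: "of_int M - 2 \<le> \<beta>" "\<beta> \<le> of_int M + 1" "poly P \<beta> = 0" by blast
  define c where "c i = - d i" for i
  define y where "y j = poly (horner (\<lambda>i. of_int (c i)) j) \<beta>" for j
  have y0: "y 0 = 1" and y_Suc: "y (Suc j) = \<beta> * y j - of_int (d j)" for j
    by (simp_all add: y_def c_def)
  have y_last: "y (Suc n) = 0" using \<beta>(3) by (simp only: y_def P_def c_def)
  \<comment> \<open>Downward induction from \<open>y (Suc n) = 0\<close>: the recursion expands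
    forwards but contracts backwards.\<close>
  have y2: "\<bar>y j\<bar> \<le> 2" if "j \<le> Suc n" for j
    using that
  proof (induction rule: inc_induct)
    case base
    show ?case by (simp add: y_last)
  next
    case (step j)
    have "\<beta> * \<bar>y j\<bar> = \<bar>y (Suc j) + of_int (d j)\<bar>"
      using \<beta> M22 by (simp add: y_Suc abs_mult)
    also have "\<dots> \<le> 2 + of_int M" using step d_le[of j] by linarith
    also have "\<dots> \<le> \<beta> * 2" using \<beta> M22 by linarith
    finally show ?case using \<beta> M22 by simp
  qed
  \<comment> \<open>6 = 2 + 2 + 2: rounding of the digit, distance of \<beta> from \<open>M\<close>,
    and the bound \<open>y2\<close> on the next point.\<close>
  have near: "\<beta> * \<bar>y j - a j\<bar> \<le> 6" if "j \<le> n" for j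
  proof -
    have "\<beta> * (y j - a j) = (of_int (d j) - of_int M * a j) + (of_int M - \<beta>) * a j + y (Suc j)"
      by (simp add: y_Suc algebra_simps)
    moreover have "\<bar>(of_int M - \<beta>) * a j\<bar> \<le> 2 * 1"
      unfolding abs_mult using \<beta> abs_pos(2)[OF that] by (intro mult_mono) auto
    moreover have "\<bar>\<beta> * (y j - a j)\<bar> = \<beta> * \<bar>y j - a j\<bar>" using \<beta> M22 by (simp add: abs_mult)
    ultimately show ?thesis using d_near[of j] y2[of "Suc j"] that by linarith
  qed
  have "20 < (of_int M - 2) * \<delta>" using M(1) \<delta>(1) by (simp add: field_simps)
  also have "\<dots> \<le> \<beta> * \<delta>" using \<beta>(1) \<delta>(1) by simp
  finally have \<beta>\<delta>: "20 < \<beta> * \<delta>" .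
  \<comment> \<open>Scaled by \<beta>, each margin exceeds 20 while each point errs by at most 6, so
    even a difference of two points keeps more than 1.\<close>
  have scale: "20 < \<beta> * t" if "\<delta> \<le> t" for t
    using \<beta>\<delta> mult_left_mono[OF that, of \<beta>] \<beta>(1) M22 by linarith
  have \<beta>0: "\<beta> > 0" using \<beta> M22 by linarith
  have near': "\<bar>\<beta> * \<bar>y j\<bar> - \<beta> * \<bar>a j\<bar>\<bar> \<le> 6" if "j \<le> n" for j
  proof -
    have "\<bar>\<beta> * \<bar>y j\<bar> - \<beta> * \<bar>a j\<bar>\<bar> = \<beta> * \<bar>\<bar>y j\<bar> - \<bar>a j\<bar>\<bar>"
      using \<beta>0 by (simp add: right_diff_distrib[symmetric] abs_mult)
    also have "\<dots> \<le> \<beta> * \<bar>y j - a j\<bar>" using \<beta>0 by (intro mult_left_mono) auto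
    finally show ?thesis using near[OF that] by simp
  qed
  have parry: "gen_parry_number \<beta>"
  proof (rule gen_parry_numberI[where n = n])
    show "\<beta> > 2" using \<beta> M22 by linarith
    show "\<bar>y j\<bar> < 1" if "j \<in> {1..n}" for j
    proof -
      have "\<beta> * \<bar>y j\<bar> < \<beta> * 1"
        using near'[of j] scale[OF \<delta>_le(3)[OF that]] that by (simp add: right_diff_distrib)
      then show ?thesis using \<beta>0 by simp
    qed
    show "\<beta> * \<bar>y j\<bar> > 1" if "j \<le> n" for j
      using near'[OF that] scale[OF \<delta>_le(4)[OF that]] by linarith
    show "\<beta> * \<bar>\<bar>y i\<bar> - \<bar>y j\<bar>\<bar> > 1" if ij: "i \<le> n" "j \<le> n" "i \<noteq> j" for i j
    proof -
      have *: "\<beta> * \<bar>s - t\<bar> = \<bar>\<beta> * s - \<beta> * t\<bar>" for s t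
        using \<beta>0 by (simp add: right_diff_distrib[symmetric] abs_mult)
      have tri: "1 < \<bar>p - q\<bar>" if "20 < \<bar>s - t\<bar>" "\<bar>p - s\<bar> \<le> 6" "\<bar>q - t\<bar> \<le> 6" for p q s t :: real
        using that by linarith
      show ?thesis
        unfolding * using scale[OF \<delta>_le(5)[OF ij]] unfolding *
        by (rule tri) (use near' ij in auto)
    qed
  qed (rule y0 y_Suc y_last)+
  have "\<bar>y j - a j\<bar> < \<eta>" if "j \<le> n" for j
  proof -
    have "\<beta> * \<bar>y j - a j\<bar> < \<beta> * \<eta>" using near[OF that] scale[OF \<delta>_le(2)] by linarith
    then show ?thesis using \<beta>0 by simp
  qed
  moreover have "K < \<beta>" using \<beta>(1) M(2) by linarith
  moreover have "even (c j)" for j using d_even by (simp add: c_def)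
  moreover have "\<not> 4 dvd c n" using d_n by (simp add: c_def)
  ultimately show ?thesis using that[OF parry _ y_def y_last] by blast
qed

section \<open>Approximation by conjugates\<close>

text \<open>Each new coefficient is taken from an open interval inside (-1, 1), avoiding 0 and the
  finitely many earlier values up to sign.\<close>

lemma perturb_distinct:
  fixes a :: "nat \<Rightarrow> real"
  assumes "\<And>j. j \<in> {1..n} \<Longrightarrow> \<bar>a j\<bar> \<le> 1" and \<eta>: "\<eta> > 0"
  shows "\<exists>b. b 0 = 1 \<and> (\<forall>j\<in>{1..n}. \<bar>b j - a j\<bar> < \<eta> \<and> 0 < \<bar>b j\<bar> \<and> \<bar>b j\<bar> < 1) \<and>
    inj_on (\<lambda>j. \<bar>b j :: real\<bar>) {..n}"
  using assms(1)
proof (induction n)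
  case 0
  show ?case by (intro exI[of _ "\<lambda>_. 1"]) auto
next
  case (Suc n)
  then obtain b where b: "b 0 = 1" "\<forall>j\<in>{1..n}. \<bar>b j - a j\<bar> < \<eta> \<and> 0 < \<bar>b j\<bar> \<and> \<bar>b j\<bar> < 1"
    "inj_on (\<lambda>j. \<bar>b j\<bar>) {..n}" by fastforce
  let ?I = "{max (a (Suc n) - \<eta>) (-1) <..< min (a (Suc n) + \<eta>) 1}"
  let ?F = "insert 0 (b ` {..n} \<union> (\<lambda>j. - b j) ` {..n})"
  have "\<bar>a (Suc n)\<bar> \<le> 1" using Suc.prems by simp
  then have "infinite ?I" using \<eta> by (intro infinite_Ioo) auto
  then have "infinite (?I - ?F)" by (intro Diff_infinite_finite) auto
  then obtain c where "c \<in> ?I - ?F" using infinite_imp_nonempty by blast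
  then have c: "\<bar>c - a (Suc n)\<bar> < \<eta>" "\<bar>c\<bar> < 1" "c \<noteq> 0" "\<bar>c\<bar> \<notin> (\<lambda>j. \<bar>b j\<bar>) ` {..n}"
    by (auto simp: abs_eq_iff)
  let ?b = "b(Suc n := c)"
  have "inj_on (\<lambda>j. \<bar>?b j\<bar>) {..n}" using b(3) by (auto simp: inj_on_def)
  moreover have "(\<lambda>j. \<bar>?b j\<bar>) ` {..n} = (\<lambda>j. \<bar>b j\<bar>) ` {..n}" by (rule image_cong) auto
  ultimately have "inj_on (\<lambda>j. \<bar>?b j\<bar>) {..Suc n}"
    using c(4) by (simp add: atMost_Suc)
  moreover have "\<forall>j\<in>{1..Suc n}. \<bar>?b j - a j\<bar> < \<eta> \<and> 0 < \<bar>?b j\<bar> \<and> \<bar>?b j\<bar> < 1"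
    using b(2) c by (auto simp: le_Suc_eq)
  ultimately show ?case using b(1) by (intro exI[of _ ?b]) auto
qed

lemma root_in_closure_\<Omega>:
  fixes a :: "nat \<Rightarrow> real"
  assumes n: "n > 0" and a: "\<And>i. i < n \<Longrightarrow> \<bar>a i\<bar> \<le> 1"
    and root: "poly (horner (\<lambda>i. of_real (a i)) n) z0 = 0"
  shows "z0 \<in> closure \<Omega>"
  unfolding closure_approachable
proof (intro allI impI)
  fix e :: real assume e: "e > 0"
  define C where "C = (\<Sum>i<n. norm z0 ^ (n - Suc i))"
  \<comment> \<open>The factor 2 pays for two errors of size \<eta>: perturbing \<open>a\<close> to
    \<open>b\<close> and realizing \<open>b\<close> by \<open>y\<close>. The summand 1 makes the
    final inequality strict.\<close>
  define \<eta> where "\<eta> = e ^ n / (2 * C + 1)"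
  have C: "C \<ge> 0" unfolding C_def by (intro sum_nonneg) simp
  have \<eta>: "\<eta> > 0" using e C by (simp add: \<eta>_def)
  have "\<exists>b. b 0 = 1 \<and> (\<forall>j\<in>{1..n}. \<bar>b j - a (j - 1)\<bar> < \<eta> \<and> 0 < \<bar>b j\<bar> \<and> \<bar>b j\<bar> < 1) \<and>
      inj_on (\<lambda>j. \<bar>b j :: real\<bar>) {..n}"
    by (rule perturb_distinct[OF _ \<eta>]) (auto intro: a)
  then obtain b where b: "b 0 = 1" "\<And>j. j \<in> {1..n} \<Longrightarrow> \<bar>b j - a (j - 1)\<bar> < \<eta> \<and> 0 < \<bar>b j\<bar> \<and> \<bar>b j\<bar> < 1"
    "inj_on (\<lambda>j. \<bar>b j :: real\<bar>) {..n}" by blast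
  \<comment> \<open>The lower bound on \<beta> puts it outside the disc of radius \<open>e\<close>
    around \<open>z0\<close>, so the root found in that disc is not \<beta> itself.\<close>
  obtain \<beta> c y where parry: "gen_parry_number \<beta>" and \<beta>: "\<beta> > norm z0 + e"
    and y: "\<And>j. y j = poly (horner (\<lambda>i. of_int (c i)) j) \<beta>" and last: "y (Suc n) = 0"
    and yb: "\<And>j. j \<le> n \<Longrightarrow> \<bar>y j - b j\<bar> < \<eta>"
    and even: "\<And>j. j \<le> n \<Longrightarrow> even (c j)" and four: "\<not> 4 dvd c n"
    using realize_orbit[of b n \<eta> "norm z0 + e"] b \<eta> by metis
  define Q where "Q = horner (\<lambda>i. complex_of_real (y (Suc i))) n"
  have "poly Q z0 = poly Q z0 - poly (horner (\<lambda>i. of_real (a i)) n) z0" by (simp add: root)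
  also have "\<dots> = (\<Sum>i<n. of_real (y (Suc i) - a i) * z0 ^ (n - Suc i))"
    by (simp add: Q_def poly_horner sum_subtractf algebra_simps)
  also have "norm \<dots> \<le> (\<Sum>i<n. norm (of_real (y (Suc i) - a i) * z0 ^ (n - Suc i)))"
    by (rule norm_sum)
  also have "\<dots> \<le> (\<Sum>i<n. (2 * \<eta>) * norm z0 ^ (n - Suc i))"
  proof (rule sum_mono)
    fix i assume "i \<in> {..<n}"
    then have "\<bar>y (Suc i) - a i\<bar> \<le> 2 * \<eta>" using yb[of "Suc i"] b(2)[of "Suc i"] by auto
    then show "norm (of_real (y (Suc i) - a i) * z0 ^ (n - Suc i)) \<le> (2 * \<eta>) * norm z0 ^ (n - Suc i)"
      unfolding norm_mult norm_power norm_of_real by (rule mult_right_mono) simp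
  qed
  also have "\<dots> = 2 * C * \<eta>" by (simp add: C_def sum_distrib_left[symmetric])
  also have "\<dots> < (2 * C + 1) * \<eta>" using \<eta> by (simp add: algebra_simps)
  also have "\<dots> = e ^ n" using C by (simp add: \<eta>_def)
  finally have "norm (poly Q z0) < e ^ degree Q" by (simp add: Q_def)
  then obtain z where z: "poly Q z = 0" "dist z z0 < e"
    using near_root[of Q e z0] n e by (auto simp: Q_def)
  define P where "P = horner c (Suc n)"
  have map_P: "(map_poly of_int P :: rat poly) = horner (\<lambda>i. of_int (c i)) (Suc n)"
    by (simp only: P_def map_poly_of_int_horner)
  have factor: "rat_eval (map_poly of_int P) x = (x - of_real \<beta>) * poly Q x" for x
    using poly_horner_factor[of "\<lambda>j. of_real (y j)" "\<lambda>i. of_int (c i)" "of_real \<beta>" n x]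
    by (simp only: map_P rat_eval_horner Q_def y of_real_poly_horner last[unfolded y] of_real_of_int_eq
        of_real_0 add_0_right)
  have "is_min_poly (map_poly of_int P) (of_real \<beta>)"
  proof (rule min_poly_eisenstein_even)
    show "even (coeff P i)" if "i < degree P" for i
      using that even by (simp only: P_def degree_horner coeff_horner)
    show "\<not> 4 dvd coeff P 0" using four by (simp add: P_def)
    show "rat_eval (map_poly of_int P) (of_real \<beta>) = 0" by (simp only: factor) simp
    show "lead_coeff P = 1" by (simp only: P_def degree_horner lead_coeff_horner)
  qed
  moreover have "norm z < \<beta>" using z(2) \<beta> norm_triangle_ineq2[of z z0] by (simp add: dist_norm)
  then have "z \<noteq> of_real \<beta>" by auto
  ultimately have "z \<in> galois_conjugates \<beta>"
    using factor[of z] z(1) by (auto simp: galois_conjugates_def rat_root_iff)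
  then show "\<exists>z\<in>\<Omega>. dist z z0 < e" using parry z(2) by (auto simp: \<Omega>_def)
qed

section \<open>Reaching the points of the right-hand side by polynomials with coefficients in
  [-1, 1]\<close>

text \<open>For nonreal \<open>w\<close>, the numbers w and w^2 span the plane over the reals; for
  real \<open>w\<close>, w alone reaches every real \<open>r\<close>. Since \<open>C\<close> depends
  only on \<open>w\<close>, small remainders are absorbed by small coefficients.\<close>

lemma real_combination:
  fixes w :: complex
  assumes "w \<noteq> 0"
  obtains C where "C \<ge> 0" "\<And>r :: complex. (w \<in> \<real> \<Longrightarrow> r \<in> \<real>) \<Longrightarrow>
    \<exists>s t :: real. \<bar>s\<bar> \<le> C * norm r \<and> \<bar>t\<bar> \<le> C * norm r \<and> of_real s * w + of_real t * w ^ 2 = r"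
proof (cases "w \<in> \<real>")
  case True
  then obtain u where u: "w = of_real u" by (elim Reals_cases)
  show ?thesis
  proof (rule that[of "inverse \<bar>u\<bar>"])
    fix r :: complex assume "w \<in> \<real> \<Longrightarrow> r \<in> \<real>"
    then obtain v where v: "r = of_real v" using True by (auto elim: Reals_cases)
    have "\<bar>v / u\<bar> \<le> inverse \<bar>u\<bar> * norm r \<and> \<bar>0\<bar> \<le> inverse \<bar>u\<bar> * norm r \<and>
        of_real (v / u) * w + of_real 0 * w ^ 2 = r"
      using assms by (simp add: u v abs_mult divide_inverse mult.commute)
    then show "\<exists>s t. \<bar>s\<bar> \<le> inverse \<bar>u\<bar> * norm r \<and> \<bar>t\<bar> \<le> inverse \<bar>u\<bar> * norm r \<and>
        of_real s * w + of_real t * w ^ 2 = r"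
      by blast
  qed simp
next
  case False
  then have im: "Im w \<noteq> 0" by (simp add: complex_is_Real_iff)
  define B where "B = inverse (norm w * \<bar>Im w\<bar>)"
  define C where "C = inverse (norm w) + B * norm w + B"
  have B: "B \<ge> 0" by (simp add: B_def)
  show ?thesis
  proof (rule that[of C])
    show "C \<ge> 0" using B by (simp add: C_def)
    fix r :: complex
    \<comment> \<open>In s + t w = r / w the imaginary part determines t, and then the real part
      s.\<close>
    define t where "t = Im (r / w) / Im w"
    define s where "s = Re (r / w) - t * Re w"
    have "of_real s + of_real t * w = r / w"
      using im by (intro complex_eqI) (simp_all add: s_def t_def)
    then have eq: "of_real s * w + of_real t * w ^ 2 = r"
      using assms by (simp add: field_simps power2_eq_square)
    have "\<bar>t\<bar> = \<bar>Im (r / w)\<bar> / \<bar>Im w\<bar>" by (simp add: t_def abs_divide)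
    also have "\<dots> \<le> norm (r / w) / \<bar>Im w\<bar>" by (intro divide_right_mono abs_Im_le_cmod) simp
    also have "\<dots> = B * norm r" by (simp add: B_def norm_mult norm_inverse divide_inverse mult.commute)
    finally have t: "\<bar>t\<bar> \<le> B * norm r" .
    have "\<bar>s\<bar> \<le> \<bar>Re (r / w)\<bar> + \<bar>t * Re w\<bar>" unfolding s_def by (rule abs_triangle_ineq4)
    also have "\<dots> \<le> norm (r / w) + (B * norm r) * norm w"
      unfolding abs_mult using t B by (intro add_mono mult_mono abs_Re_le_cmod) auto
    also have "\<dots> = (inverse (norm w) + B * norm w) * norm r"
      by (simp add: norm_mult norm_inverse divide_inverse algebra_simps)
    also have "\<dots> \<le> C * norm r" unfolding C_def using B by (intro mult_right_mono) auto
    finally have "\<bar>s\<bar> \<le> C * norm r" .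
    moreover have "B * norm r \<le> C * norm r" unfolding C_def using B by (intro mult_right_mono) auto
    with t have "\<bar>t\<bar> \<le> C * norm r" by linarith
    ultimately show "\<exists>s t. \<bar>s\<bar> \<le> C * norm r \<and> \<bar>t\<bar> \<le> C * norm r \<and> of_real s * w + of_real t * w ^ 2 = r"
      using eq by blast
  qed
qed

lemma nonreal_disc_in_closure_\<Omega>:
  assumes z: "z \<notin> \<real>" "norm z < 1"
  shows "z \<in> closure \<Omega>"
proof -
  have z0: "z \<noteq> 0" using z by auto
  obtain C where C: "C \<ge> 0" "\<And>r. (z \<in> \<real> \<Longrightarrow> r \<in> \<real>) \<Longrightarrow>
    \<exists>s t :: real. \<bar>s\<bar> \<le> C * norm r \<and> \<bar>t\<bar> \<le> C * norm r \<and> of_real s * z + of_real t * z ^ 2 = r"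
    using real_combination[OF z0] by blast
  have "(\<lambda>n. C * norm z ^ n) \<longlonglongrightarrow> C * 0" using z(2) by (intro tendsto_intros LIMSEQ_power_zero) simp
  then have "\<forall>\<^sub>F n in sequentially. C * norm z ^ n < 1" by (rule order_tendstoD) simp
  then obtain N where N: "\<And>n. n \<ge> N \<Longrightarrow> C * norm z ^ n < 1" by (auto simp: eventually_sequentially)
  obtain s t :: real where st: "\<bar>s\<bar> \<le> C * norm (- (z ^ (N + 3)))" "\<bar>t\<bar> \<le> C * norm (- (z ^ (N + 3)))"
    "of_real s * z + of_real t * z ^ 2 = - (z ^ (N + 3))" using C(2)[of "- (z ^ (N + 3))"] z by blast
  have bound: "\<bar>s\<bar> \<le> 1" "\<bar>t\<bar> \<le> 1"
    using st(1,2) N[of "N + 3"] by (simp_all add: norm_power)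
  have "z * (of_real s + of_real t * z + z ^ (N + 2)) = of_real s * z + of_real t * z ^ 2 + z ^ (N + 3)"
    by (simp add: power2_eq_square algebra_simps eval_nat_numeral)
  also have "\<dots> = 0" by (simp add: st(3))
  finally have "z * (of_real s + of_real t * z + z ^ (N + 2)) = 0" .
  then have eq: "of_real s + of_real t * z + z ^ (N + 2) = 0" using z0 by simp
  \<comment> \<open>In Horner order the last two places, \<open>N\<close> and \<open>Suc N\<close>,
    hold the coefficients of z and 1.\<close>
  define a where "a i = (if i = N then t else if i = Suc N then s else 0)" for i
  show ?thesis
  proof (rule root_in_closure_\<Omega>[of "N + 2" a])
    have "(\<Sum>i<N. of_real (a i) * z ^ (N + 2 - Suc i)) = 0" by (rule sum.neutral) (simp add: a_def)
    then show "poly (horner (\<lambda>i. of_real (a i)) (N + 2)) z = 0"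
      unfolding poly_horner using eq by (simp add: a_def algebra_simps)
  qed (use bound in \<open>auto simp: a_def\<close>)
qed

lemma inverse_\<G>_in_closure_\<Omega>:
  assumes z: "norm z > 1" "inverse z \<in> \<G>"
  shows "z \<in> closure \<Omega>"
proof -
  define w where "w = inverse z"
  have z0: "z \<noteq> 0" and w0: "w \<noteq> 0" using z by (auto simp: w_def)
  obtain a :: "nat \<Rightarrow> real" where a: "\<forall>j\<ge>1. a j \<in> {-1..1}"
    and zero: "1 + (\<Sum>j. of_real (a (Suc j)) * w ^ Suc j) = 0" and w1: "w \<in> ball 0 1"
    using z(2) by (auto simp: \<G>_def \<F>_def w_def)
  have summ: "summable (\<lambda>j. of_real (a (Suc j)) * w ^ Suc j)" by (rule summable_\<F>[OF a w1])
  have a1: "\<bar>a (Suc j)\<bar> \<le> 1" for j using a[rule_format, of "Suc j"] by auto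
  have approx: "z /\<^sub>R q \<in> closure \<Omega>" if q: "q > 1" for q :: real
  proof -
    \<comment> \<open>Scaling the point by \<open>q\<close> and the coefficients by inverse powers
      of \<open>q\<close> leaves each term unchanged, but bounds the coefficients by
      \<open>inverse q\<close>; this frees a margin \<open>1 - inverse q\<close>.\<close>
    define v where "v = q *\<^sub>R w"
    define b where "b j = a (Suc j) / q ^ Suc j" for j
    define r where "r n = (\<Sum>j. of_real (b (j + n)) * v ^ Suc (j + n))" for n
    have summand: "of_real (b j) * v ^ Suc j = of_real (a (Suc j)) * w ^ Suc j" for j
      using q by (simp add: b_def v_def scaleR_conv_of_real power_mult_distrib del: power_Suc)
    have v0: "v \<noteq> 0" using q w0 by (simp add: v_def)
    have summ': "summable (\<lambda>j. of_real (b j) * v ^ Suc j)" using summ by (simp only: summand)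
    have r_eq: "1 + (\<Sum>j<n. of_real (b j) * v ^ Suc j) + r n = 0" for n
      using suminf_split_initial_segment[OF summ', of n] zero by (simp add: r_def summand add_ac del: power_Suc)
    have "r \<longlonglongrightarrow> 0"
      using suminf_exist_split2[OF summ'] unfolding r_def .
    \<comment> \<open>A real \<open>v\<close> admits only real remainders in
      \<open>real_combination\<close>.\<close>
    have r_real: "r n \<in> \<real>" if "v \<in> \<real>" for n
    proof -
      have "r n = - (1 + (\<Sum>j<n. of_real (b j) * v ^ Suc j))"
        using r_eq[of n] unfolding eq_neg_iff_add_eq_0 by (simp only: add.commute)
      then show ?thesis using that by (auto intro!: Reals_minus Reals_add sum_in_Reals Reals_mult Reals_power simp del: power_Suc)
    qed
    obtain C where C: "C \<ge> 0" "\<And>r. (v \<in> \<real> \<Longrightarrow> r \<in> \<real>) \<Longrightarrow>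
      \<exists>s t :: real. \<bar>s\<bar> \<le> C * norm r \<and> \<bar>t\<bar> \<le> C * norm r \<and> of_real s * v + of_real t * v ^ 2 = r"
      using real_combination[OF v0] by blast
    have "(\<lambda>n. C * norm (r n)) \<longlonglongrightarrow> C * 0"
      using \<open>r \<longlonglongrightarrow> 0\<close> by (intro tendsto_intros tendsto_norm_zero)
    moreover have "C * 0 < 1 - inverse q" using q by (simp add: inverse_less_1_iff)
    ultimately have "\<forall>\<^sub>F n in sequentially. C * norm (r n) < 1 - inverse q"
      by (rule order_tendstoD)
    then obtain N where "\<forall>n\<ge>N. C * norm (r n) < 1 - inverse q"
      by (auto simp: eventually_sequentially)
    then have N: "C * norm (r (N + 2)) < 1 - inverse q" by simp
    obtain s t :: real where st: "\<bar>s\<bar> \<le> C * norm (r (N + 2))" "\<bar>t\<bar> \<le> C * norm (r (N + 2))"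
      "of_real s * v + of_real t * v ^ 2 = r (N + 2)" using C(2)[of "r (N + 2)"] r_real by blast
    define c where "c j = b j + (if j = 0 then s else if j = 1 then t else 0)" for j
    have b_le: "\<bar>b j\<bar> \<le> inverse q" for j
    proof -
      have "q * 1 \<le> q * q ^ j" using q by (intro mult_left_mono one_le_power) auto
      then have "\<bar>a (Suc j)\<bar> * inverse (q ^ Suc j) \<le> 1 * inverse q"
        using a1[of j] q by (intro mult_mono le_imp_inverse_le) auto
      moreover have "\<bar>b j\<bar> = \<bar>a (Suc j)\<bar> * inverse (q ^ Suc j)"
        using q by (simp add: b_def abs_mult divide_inverse del: power_Suc)
      ultimately show ?thesis by simp
    qed
    have "(\<Sum>j<N + 2. of_real (if j = 0 then s else if j = 1 then t else 0) * v ^ Suc j) =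
        of_real s * v + of_real t * v ^ 2"
      unfolding add_2_eq_Suc' sum.lessThan_Suc_shift by (simp add: power2_eq_square)
    then have "(\<Sum>j<N + 2. of_real (c j) * v ^ Suc j) =
        (\<Sum>j<N + 2. of_real (b j) * v ^ Suc j) + (of_real s * v + of_real t * v ^ 2)"
      by (simp only: c_def of_real_add distrib_right sum.distrib)
    then have "1 + (\<Sum>j<N + 2. of_real (c j) * v ^ Suc j) = 0"
      using r_eq[of "N + 2"] by (simp only: st(3) add.assoc)
    \<comment> \<open>Multiplication by \<open>inverse v ^ (N + 2)\<close> reverses the truncated
      series into a monic polynomial at \<open>inverse v\<close>.\<close>
    moreover have "inverse v ^ (N + 2) * (of_real (c j) * v ^ Suc j) =
        of_real (c j) * inverse v ^ (N + 2 - Suc j)" if "j < N + 2" for j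
    proof -
      have "inverse v ^ (N + 2) = inverse v ^ (N + 2 - Suc j) * inverse v ^ Suc j"
        using that by (simp only: power_add[symmetric]) simp
      then show ?thesis using v0 by (simp add: power_inverse del: power_Suc)
    qed
    then have "inverse v ^ (N + 2) * (\<Sum>j<N + 2. of_real (c j) * v ^ Suc j) =
        (\<Sum>j<N + 2. of_real (c j) * inverse v ^ (N + 2 - Suc j))"
      unfolding sum_distrib_left by (intro sum.cong) auto
    then have "poly (horner (\<lambda>i. of_real (c i)) (N + 2)) (inverse v) =
        inverse v ^ (N + 2) * (1 + (\<Sum>j<N + 2. of_real (c j) * v ^ Suc j))"
      by (simp only: poly_horner distrib_left mult_1_right)
    ultimately have "poly (horner (\<lambda>i. of_real (c i)) (N + 2)) (inverse v) = 0"
      by (simp only: mult_zero_right)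
    then have "inverse v \<in> closure \<Omega>"
    proof (rule root_in_closure_\<Omega>[rotated 2])
      fix i
      have "\<bar>c i\<bar> \<le> \<bar>b i\<bar> + C * norm (r (N + 2))"
        unfolding c_def using st(1,2) C(1) by (intro order_trans[OF abs_triangle_ineq] add_left_mono) auto
      then show "\<bar>c i\<bar> \<le> 1" using b_le[of i] N by linarith
    qed simp
    also have "inverse v = z /\<^sub>R q"
      by (simp add: v_def w_def scaleR_conv_of_real of_real_inverse inverse_mult_distrib)
    finally show ?thesis .
  qed
  \<comment> \<open>Undo the outward push by letting \<open>q\<close> tend to 1.\<close>
  have "(\<lambda>n. z /\<^sub>R (1 + inverse (real (Suc n)))) \<longlonglongrightarrow> z /\<^sub>R (1 + 0)"
    by (intro tendsto_intros LIMSEQ_inverse_real_of_nat) simp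
  moreover have "z /\<^sub>R (1 + inverse (real (Suc n))) \<in> closure \<Omega>" for n by (intro approx) simp
  ultimately show ?thesis using closed_sequentially[of "closure \<Omega>"] by fastforce
qed

lemma cball_subset_closure_nonreal_disc: "cball 0 1 \<subseteq> closure {z::complex. z \<notin> \<real> \<and> norm z < 1}"
proof
  fix z :: complex assume z: "z \<in> cball 0 1"
  show "z \<in> closure {z::complex. z \<notin> \<real> \<and> norm z < 1}"
    unfolding closure_approachable
  proof (intro allI impI)
    fix e :: real assume e: "e > 0"
    have "z \<in> closure (ball 0 1)" using z by simp
    then obtain x where x: "norm x < 1" "dist x z < e / 2"
      using e unfolding closure_approachable by (metis half_gt_zero mem_ball_0)
    define d where "d = min (e / 2) (1 - norm x)"
    have d: "d > 0" using e x by (simp add: d_def)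
    \<comment> \<open>The vertical shift has the sign of \<open>Im x\<close>, so it cannot land on
      the real axis; its length is below \<open>1 - norm x\<close>, so it stays in the disc.\<close>
    define y where "y = x + (if Im x \<ge> 0 then 1 else -1) * of_real (d / 2) * \<i>"
    have "dist y x = d / 2" using d by (simp add: y_def dist_norm norm_mult)
    moreover have "Im y \<noteq> 0" using d by (auto simp: y_def)
    ultimately show "\<exists>y\<in>{z. z \<notin> \<real> \<and> norm z < 1}. dist y z < e"
      using x d dist_triangle[of y z x] norm_triangle_ineq2[of y x]
      by (intro bexI[of _ y]) (auto simp: d_def complex_is_Real_iff dist_norm)
  qed
qed

theorem theorem5p6:
  shows "closure \<Omega> = cball 0 1 \<union> {z. norm z > 1 \<and> inverse z \<in> \<G>}"
proof (rule antisym)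
  show "closure \<Omega> \<subseteq> cball 0 1 \<union> {z. norm z > 1 \<and> inverse z \<in> \<G>}"
    using inverse_conjugate_in_\<G> by (intro closure_minimal closed_cball_Un_inverse_\<G>) auto
  have "closure {z::complex. z \<notin> \<real> \<and> norm z < 1} \<subseteq> closure \<Omega>"
    using nonreal_disc_in_closure_\<Omega> by (intro closure_minimal) auto
  then show "cball 0 1 \<union> {z. norm z > 1 \<and> inverse z \<in> \<G>} \<subseteq> closure \<Omega>"
    using cball_subset_closure_nonreal_disc inverse_\<G>_in_closure_\<Omega> by blast
qed

end
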